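(* Let $\mathcal{W}$ be the set of solutions $W:V\to\mathbb{R}$ of the discrete Hamilton–Jacobi equation $$W(x)=\min_{y:(y,x)\in E}\{W(y)+\Delta(y,x)\}\qquad\forall x\in V.$$ Then $\mathcal{W}$ coincides with the family of functions $$W_\lambda(x)=\min_{C_i\in\mathcal{C}}\{W_{C_i}(x)+\lambda_i\},\qquad x\in V,$$ where the vector $\lambda=(\lambda_i)_{C_i\in\mathcal{C}}\in\mathbb{R}^{|\mathcal{C}|}$ ranges over the polyhedron defined by the inequalities $$\lambda_i-\lambda_j\le d(C_j,C_i)\qquad\text{for all } C_i,C_j\in\mathcal{C}.$$
   Context: $\mathcal{G}=(V,E)$ is a finite, strongly connected directed graph without loops (no edges $(x,x)$), and $\Delta:E\to[0,+\infty)$ is a weight function. Standing assumption: for every $x\in V$ there is exactly one edge $(x,y)\in E$ exiting from $x$ with $\Delta(x,y)=0$. Let $E_0\subseteq E$ be the set of edges with $\Delta=0$; in $(V,E_0)$ each vertex has exactly one exiting edge. Let $\mathcal{C}=\{C_1,\dots,C_{|\mathcal C|}\}$ be the set of directed cycles of $(V,E_0)$; a cycle is a sequence $(z_1,\dots,z_n)$ of distinct vertices with $(z_i,z_{i+1})$ an edge for each $i$, $z_{n+1}=z_1$ (a cycle is identified up to cyclic rotation, and also denotes its vertex set). For $x,y\in V$, $d(x,y):=\min\sum_{i=0}^{n-1}\Delta(x_i,x_{i+1})$ over directed paths $(x_0,\dots,x_n)$ in $\mathcal{G}$ with $x_0=x$, $x_n=y$ (the trivial path is allowed, so $d(x,x)=0$).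 For $S,T\subseteq V$: $d(T,y)=\min_{x\in T}d(x,y)$ and $d(T,S)=\min_{x\in T,y\in S}d(x,y)$. For $C\in\mathcal{C}$ the quasipotential based on $C$ is $W_C(x):=d(C,x)$, $x\in V$. *)

theory Defs
  imports "Graph_Theory.Graph_Theory" "HOL-Library.FuncSet"
begin

text \<open>
  A graph is a \<^typ>\<open>'a pair_pre_digraph\<close> (vertex set \<^term>\<open>pverts G\<close>, edge set
  \<^term>\<open>parcs G\<close> of ordered pairs). A weight is a total function on pairs of which only the
  values on edges matter. Functions on a finite set \<open>A\<close> (candidate solutions, vectors
  indexed by cycles) are elements of \<open>A \<rightarrow>\<^sub>E UNIV\<close>, so that equality
  of functions is equality on \<open>A\<close>.
\<close>

definition zero_graph :: "'a pair_pre_digraph \<Rightarrow> ('a \<times> 'a) weight_fun \<Rightarrow> 'a pair_pre_digraph" where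
  "zero_graph G \<Delta> = \<lparr>pverts = pverts G, parcs = {e \<in> parcs G. \<Delta> e = 0}\<rparr>"

text \<open>
  The library represents a cycle \<open>(z\<^sub>1, \<dots>, z\<^sub>n)\<close> by its list of
  arcs \<open>[(z\<^sub>1, z\<^sub>2), \<dots>, (z\<^sub>n, z\<^sub>1)]\<close>. Cycles up to cyclic
  rotation are the classes of such lists.
\<close>

definition rotation_rel :: "('b list \<times> 'b list) set" where
  "rotation_rel = {(p, q). \<exists>n. q = rotate n p}"

definition zero_cycles ::
  "'a pair_pre_digraph \<Rightarrow> ('a \<times> 'a) weight_fun \<Rightarrow> ('a \<times> 'a) list set set" where
  "zero_cycles G \<Delta> = {p. pre_digraph.cycle (with_proj (zero_graph G \<Delta>)) p} // rotation_rel"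

definition cycle_verts :: "('a \<times> 'a) list set \<Rightarrow> 'a set" where
  "cycle_verts C = (\<Union>p\<in>C. fst ` set p)"

text \<open>
  The library's shortest-path cost \<^const>\<open>wf_digraph.\<mu>\<close> is an infimum in the
  extended reals over all walks, including the empty one. Under the assumptions used here it is a
  finite minimum; see \<open>path_dist_is_min\<close>.
\<close>

definition path_dist ::
  "'a pair_pre_digraph \<Rightarrow> ('a \<times> 'a) weight_fun \<Rightarrow> 'a \<Rightarrow> 'a \<Rightarrow> real" where
  "path_dist G \<Delta> x y = real_of_ereal (wf_digraph.\<mu> (with_proj G) \<Delta> x y)"

lemma path_dist_is_min:
  assumes "pair_digraph G" "strongly_connected (with_proj G)"
    and "\<And>e. e \<in> parcs G \<Longrightarrow> 0 \<le> \<Delta> e"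
    and "x \<in> pverts G" "y \<in> pverts G"
  shows "\<exists>p. pre_digraph.awalk (with_proj G) x p y \<and> path_dist G \<Delta> x y = sum_list (map \<Delta> p)"
    and "pre_digraph.awalk (with_proj G) x p y \<Longrightarrow> path_dist G \<Delta> x y \<le> sum_list (map \<Delta> p)"
proof -
  interpret pair_digraph G by fact
  have "x \<rightarrow>\<^sup>*\<^bsub>with_proj G\<^esub> y"
    using assms by (auto simp: strongly_connected_def)
  then obtain q where q: "apath x q y" "\<mu> \<Delta> x y = awalk_cost \<Delta> q"
    using min_cost_awalk[of x y \<Delta>] assms(3) by auto
  show "\<exists>p. awalk x p y \<and> path_dist G \<Delta> x y = sum_list (map \<Delta> p)"
    using q by (intro exI[of _ q]) (auto simp: path_dist_def awalk_cost_def awalkI_apath)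
  show "path_dist G \<Delta> x y \<le> sum_list (map \<Delta> p)" if "awalk x p y"
    using min_cost_le_walk_cost[OF that, of \<Delta>] q by (simp add: path_dist_def awalk_cost_def)
qed

definition dist_from_set ::
  "'a pair_pre_digraph \<Rightarrow> ('a \<times> 'a) weight_fun \<Rightarrow> 'a set \<Rightarrow> 'a \<Rightarrow> real" where
  "dist_from_set G \<Delta> T y = Min ((\<lambda>x. path_dist G \<Delta> x y) ` T)"

definition dist_sets ::
  "'a pair_pre_digraph \<Rightarrow> ('a \<times> 'a) weight_fun \<Rightarrow> 'a set \<Rightarrow> 'a set \<Rightarrow> real" where
  "dist_sets G \<Delta> T S = Min ((\<lambda>(x, y). path_dist G \<Delta> x y) ` (T \<times> S))"

definition quasipotential ::
  "'a pair_pre_digraph \<Rightarrow> ('a \<times> 'a) weight_fun \<Rightarrow> ('a \<times> 'a) list set \<Rightarrow> 'a \<Rightarrow> real" where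
  "quasipotential G \<Delta> C x = dist_from_set G \<Delta> (cycle_verts C) x"

definition hj_solutions ::
  "'a pair_pre_digraph \<Rightarrow> ('a \<times> 'a) weight_fun \<Rightarrow> ('a \<Rightarrow> real) set" where
  "hj_solutions G \<Delta> = {W \<in> pverts G \<rightarrow>\<^sub>E UNIV.
     \<forall>x \<in> pverts G. W x = Min ((\<lambda>y. W y + \<Delta> (y, x)) ` {y. (y, x) \<in> parcs G})}"

definition cycle_polyhedron ::
  "'a pair_pre_digraph \<Rightarrow> ('a \<times> 'a) weight_fun \<Rightarrow> (('a \<times> 'a) list set \<Rightarrow> real) set" where
  "cycle_polyhedron G \<Delta> = {l \<in> zero_cycles G \<Delta> \<rightarrow>\<^sub>E UNIV.
     \<forall>C \<in> zero_cycles G \<Delta>. \<forall>D \<in> zero_cycles G \<Delta>.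
       l C - l D \<le> dist_sets G \<Delta> (cycle_verts D) (cycle_verts C)}"

definition hj_combination ::
  "'a pair_pre_digraph \<Rightarrow> ('a \<times> 'a) weight_fun \<Rightarrow> (('a \<times> 'a) list set \<Rightarrow> real) \<Rightarrow> 'a \<Rightarrow> real" where
  "hj_combination G \<Delta> l =
     (\<lambda>x \<in> pverts G. Min ((\<lambda>C. quasipotential G \<Delta> C x + l C) ` zero_cycles G \<Delta>))"

end

theory Submission
  imports Defs
begin

text \<open>
  A solution \<open>W\<close> is subadditive along arcs, hence constant on each zero cycle \<open>C\<close>; call this
  constant \<open>\<lambda>\<^sub>C\<close>. Subadditivity gives both the polyhedron inequalities and
  \<open>W \<le> W\<^sub>C + \<lambda>\<^sub>C\<close>. Conversely, starting from \<open>x\<close> and repeatedly moving to a predecessor that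
  attains the minimum, one runs into a vertex \<open>z\<close> twice. The weights along this closed walk sum up
  to \<open>W z - W z = 0\<close>, so \<open>z\<close> lies on a zero cycle, and \<open>W x = W z + d(z, x)\<close>.
  For the other inclusion, the last arc of a shortest walk from a cycle to \<open>x\<close> (or, if that walk is
  empty, the arc of the cycle entering \<open>x\<close>) attains the minimum in the equation at \<open>x\<close>.
\<close>

section \<open>Sequences in a finite set\<close>

lemma finite_range_repeats:
  fixes g :: "nat \<Rightarrow> 'b"
  assumes "finite A" "\<And>n. g n \<in> A"
  obtains i j where "i < j" "g i = g j"
proof -
  have "finite (range g)"
    using assms by (auto intro: finite_subset)
  then have "\<not> inj g"
    using finite_imageD infinite_UNIV_nat by blast
  then obtain i j where "i \<noteq> j" "g i = g j"
    by (auto simp: inj_on_def)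
  then show thesis
    using that by (metis linorder_neqE_nat)
qed

text \<open>Turns the stretch of an orbit between two visits to one vertex into reachability. It is
  applied to the zero arcs for a forward orbit and to their converse for a backward one.\<close>

lemma rtrancl_along_sequence:
  assumes "\<And>n. i \<le> n \<Longrightarrow> n < j \<Longrightarrow> (g n, g (Suc n)) \<in> R" "i \<le> j"
  shows "(g i, g j) \<in> R\<^sup>*"
  using assms(2,1)
  by (induction j rule: dec_induct) (auto intro: rtrancl_into_rtrancl)

section \<open>The digraph and its zero-weight subgraph\<close>

locale zero_exit_digraph = pair_digraph G for G :: "'a pair_pre_digraph" +
  fixes \<Delta> :: "('a \<times> 'a) weight_fun"
  assumes strong: "strongly_connected (with_proj G)"
    and nonneg: "\<And>e. e \<in> parcs G \<Longrightarrow> 0 \<le> \<Delta> e"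
    and zero_exit: "\<And>x. x \<in> pverts G \<Longrightarrow> \<exists>y. (x, y) \<in> parcs G \<and> \<Delta> (x, y) = 0"
begin

text \<open>The arcs of the zero graph as a bare relation, so that reachability along them is a
  reflexive transitive closure and needs no explicit walks.\<close>

definition zero_arcs :: "('a \<times> 'a) set" where
  "zero_arcs = {e \<in> parcs G. \<Delta> e = 0}"

lemma parcs_zero_graph [simp]: "parcs (zero_graph G \<Delta>) = zero_arcs"
  and pverts_zero_graph [simp]: "pverts (zero_graph G \<Delta>) = pverts G"
  by (simp_all add: zero_graph_def zero_arcs_def)

lemma zero_arcs_subset: "zero_arcs \<subseteq> parcs G"
  by (auto simp: zero_arcs_def)

text \<open>Deleting arcs preserves finiteness and the absence of loops. This opens the theory of
  walks and cycles for the zero graph, under the prefix \<open>zero\<close>.\<close>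

lemma pair_digraph_zero_graph: "pair_digraph (zero_graph G \<Delta>)"
  using zero_arcs_subset in_arcsD1 in_arcsD2 pair_no_loops
    pair_finite_verts finite_subset[OF zero_arcs_subset pair_finite_arcs]
  by unfold_locales fastforce+

sublocale zero: pair_digraph "zero_graph G \<Delta>"
  by (rule pair_digraph_zero_graph)

lemma pverts_nonempty: "pverts G \<noteq> {}"
  using strong by (auto simp: strongly_connected_def)

section \<open>Shortest-path distances\<close>

lemma path_dist_attained:
  assumes "x \<in> pverts G" "y \<in> pverts G"
  obtains p where "awalk x p y" "path_dist G \<Delta> x y = sum_list (map \<Delta> p)"
  using path_dist_is_min(1)[where \<Delta> = \<Delta>, OF pair_digraph_axioms strong nonneg assms] by blast

lemma path_dist_le:
  assumes "awalk x p y"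
  shows "path_dist G \<Delta> x y \<le> sum_list (map \<Delta> p)"
proof -
  have "x \<in> pverts G" "y \<in> pverts G"
    using assms by auto
  then show ?thesis
    using path_dist_is_min(2)[where \<Delta> = \<Delta>, OF pair_digraph_axioms strong nonneg] assms
    by blast
qed

lemma path_dist_self_le: "x \<in> pverts G \<Longrightarrow> path_dist G \<Delta> x x \<le> 0"
  using path_dist_le[of x "[]" x] by (simp add: awalk_Nil_iff)

lemma path_dist_step:
  assumes "x \<in> pverts G" "(y, z) \<in> parcs G"
  shows "path_dist G \<Delta> x z \<le> path_dist G \<Delta> x y + \<Delta> (y, z)"
proof -
  have yz: "y \<in> pverts G" "z \<in> pverts G"
    using assms in_arcsD1 in_arcsD2 by auto
  obtain p where p: "awalk x p y" "path_dist G \<Delta> x y = sum_list (map \<Delta> p)"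
    using path_dist_attained assms(1) yz(1) by blast
  have "awalk y [(y, z)] z"
    using assms yz by (simp add: awalk_simps)
  then have "awalk x (p @ [(y, z)]) z"
    using p(1) by (rule awalk_appendI[rotated])
  from path_dist_le[OF this] show ?thesis
    by (simp add: p(2))
qed

text \<open>Prepends an arc to a shortest walk; needed where a walk grows backwards from a fixed
  end.\<close>

lemma path_dist_first_step:
  assumes "(x, y) \<in> parcs G" "z \<in> pverts G"
  shows "path_dist G \<Delta> x z \<le> \<Delta> (x, y) + path_dist G \<Delta> y z"
proof -
  obtain p where p: "awalk y p z" "path_dist G \<Delta> y z = sum_list (map \<Delta> p)"
    using path_dist_attained assms in_arcsD2 by blast
  then have "awalk x ((x, y) # p) z"
    using assms by (simp add: awalk_simps)
  from path_dist_le[OF this] show ?thesis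
    by (simp add: p(2))
qed

text \<open>Leave x along a zero arc and return by strong connectivity: the last arc of this closed
  walk enters x. Hence the minimum in the equation ranges over a nonempty set.\<close>

lemma has_predecessor:
  assumes "x \<in> pverts G"
  obtains y where "(y, x) \<in> parcs G"
proof -
  obtain y where y: "(x, y) \<in> parcs G"
    using zero_exit assms by blast
  then obtain p where p: "awalk y p x"
    using path_dist_attained assms in_arcsD2 by blast
  show thesis
  proof (cases p rule: rev_cases)
    case Nil
    then show thesis
      using p y that by (auto simp: awalk_simps)
  next
    case (snoc q e)
    then have "e \<in> parcs G" "snd e = x"
      using p by (auto simp: awalk_simps)
    then show thesis
      using that by (cases e) auto
  qed
qed

section \<open>Cycles of the zero graph\<close>

lemma zero_cycle_representative:
  assumes "C \<in> zero_cycles G \<Delta>"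
  obtains u p where "zero.awalk u p u" "p \<noteq> []" "cycle_verts C = fst ` set p"
proof -
  obtain p where p: "zero.cycle p" "C = rotation_rel `` {p}"
    using assms by (auto simp: zero_cycles_def elim!: quotientE)
  \<comment> \<open>Rotating a list keeps its set of arcs, so one representative already yields all
    vertices of the class.\<close>
  have "cycle_verts C = fst ` set p"
    by (auto simp: p(2) cycle_verts_def rotation_rel_def) (metis fst_conv image_eqI rotate0 id_apply)
  then show thesis
    using p(1) that by (auto simp: zero.cycle_def)
qed

text \<open>The arcs of a cycle are distinct, so its length is at most the number of zero arcs, and
  there are finitely many such lists.\<close>

lemma finite_zero_cycles: "finite (zero_cycles G \<Delta>)"
proof -
  have "{p. zero.cycle p} \<subseteq> {p. set p \<subseteq> zero_arcs \<and> length p \<le> card zero_arcs}"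
  proof safe
    fix p assume "zero.cycle p"
    then obtain u where u: "zero.awalk u p u" and "distinct p"
      by (auto simp: zero.cycle_conv)
    then show "length p \<le> card zero_arcs"
      using zero_arcs_subset pair_finite_arcs
      by (metis card_mono distinct_card finite_subset parcs_zero_graph zero.awalkE')
  qed (auto simp: zero.cycle_def dest: subsetD elim!: zero.awalkE')
  then have "finite {p. zero.cycle p}"
    using finite_lists_length_le[OF finite_subset[OF zero_arcs_subset pair_finite_arcs]]
    by (rule finite_subset)
  then show ?thesis
    by (simp add: zero_cycles_def quotient_def)
qed

lemma cycle_verts_in_pverts:
  assumes "C \<in> zero_cycles G \<Delta>"
  shows "cycle_verts C \<subseteq> pverts G"
proof -
  obtain u p where p: "zero.awalk u p u" "cycle_verts C = fst ` set p"
    using assms by (rule zero_cycle_representative)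
  have "set p \<subseteq> zero_arcs"
    using p(1) by (auto elim!: zero.awalkE')
  then show ?thesis
    using p(2) zero_arcs_subset in_arcsD1 by fastforce
qed

lemma finite_cycle_verts: "C \<in> zero_cycles G \<Delta> \<Longrightarrow> finite (cycle_verts C)"
  using cycle_verts_in_pverts pair_finite_verts finite_subset by blast

lemma cycle_verts_nonempty: "C \<in> zero_cycles G \<Delta> \<Longrightarrow> cycle_verts C \<noteq> {}"
  by (erule zero_cycle_representative) auto

lemma zero_awalk_imp_rtrancl:
  assumes "zero.awalk u p v"
  shows "(u, v) \<in> zero_arcs\<^sup>*"
  using assms
proof (induction p arbitrary: u)
  case (Cons e p)
  then show ?case
    by (cases e) (auto simp: zero.awalk_simps intro: converse_rtrancl_into_rtrancl)
qed (simp add: zero.awalk_simps)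

lemma rtrancl_imp_zero_awalk:
  assumes "(u, v) \<in> zero_arcs\<^sup>*" "v \<in> pverts G"
  shows "\<exists>p. zero.awalk u p v"
  using assms
proof (induction rule: converse_rtrancl_induct)
  case base
  then have "zero.awalk v [] v"
    by (simp add: zero.awalk_simps)
  then show ?case ..
next
  case (step x y)
  then obtain p where "zero.awalk y p v"
    by blast
  with step have "zero.awalk x ((x, y) # p) v"
    by (simp add: zero.awalk_simps)
  then show ?case ..
qed

text \<open>Cutting the closed walk at a vertex v gives walks from its base point u to v and from v
  back to u; any two cycle vertices are thus joined through u.\<close>

lemma cycle_verts_connected:
  assumes "C \<in> zero_cycles G \<Delta>" "x \<in> cycle_verts C" "y \<in> cycle_verts C"
  shows "(x, y) \<in> zero_arcs\<^sup>*"
proof -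
  obtain u p where p: "zero.awalk u p u" "cycle_verts C = fst ` set p"
    using assms(1) by (rule zero_cycle_representative)
  have "(u, v) \<in> zero_arcs\<^sup>* \<and> (v, u) \<in> zero_arcs\<^sup>*" if "v \<in> cycle_verts C" for v
  proof -
    obtain w where "(v, w) \<in> set p"
      using \<open>v \<in> cycle_verts C\<close> p(2) by auto
    then obtain q r where "p = q @ (v, w) # r"
      by (auto simp: in_set_conv_decomp)
    with p(1) have "zero.awalk u q v" "zero.awalk v ((v, w) # r) u"
      by (auto simp: zero.awalk_simps)
    then show ?thesis
      using zero_awalk_imp_rtrancl by blast
  qed
  then show ?thesis
    using assms by (meson rtrancl_trans)
qed

lemma cycle_verts_predecessor:
  assumes "C \<in> zero_cycles G \<Delta>" "x \<in> cycle_verts C"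
  obtains y where "y \<in> cycle_verts C" "(y, x) \<in> zero_arcs"
proof -
  obtain u p where p: "zero.awalk u p u" "p \<noteq> []" "cycle_verts C = fst ` set p"
    using assms(1) by (rule zero_cycle_representative)
  obtain w where "(x, w) \<in> set p"
    using assms(2) p(3) by auto
  then obtain q r where qr: "p = q @ (x, w) # r"
    by (auto simp: in_set_conv_decomp)
  \<comment> \<open>Common to both cases below: an arc of p that ends a zero walk to x starts at the
    wanted predecessor.\<close>
  have last: thesis if "zero.awalk v (s @ [e]) x" "e \<in> set p" for v s e
  proof -
    have "e \<in> zero_arcs" "snd e = x"
      using that by (auto simp: zero.awalk_simps)
    then show thesis
      using that(2) p(3) \<open>\<And>y. \<lbrakk>y \<in> cycle_verts C; (y, x) \<in> zero_arcs\<rbrakk> \<Longrightarrow> thesis\<close>[of "fst e"]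
      by (cases e) force
  qed
  show thesis
  proof (cases q rule: rev_cases)
    case Nil
    \<comment> \<open>The closed walk starts at x itself, so the arc entering x is the last one of
      p.\<close>
    then have "u = x"
      using p(1) qr by (auto simp: zero.awalk_simps)
    then have "zero.awalk u (butlast p @ [last p]) x"
      using p(1,2) by simp
    then show thesis
      using last p(2) last_in_set by blast
  next
    case (snoc s e)
    have "zero.awalk u q x"
      using p(1) qr by (auto simp: zero.awalk_Cons_iff)
    then have "zero.awalk u (s @ [e]) x"
      by (simp add: snoc)
    then show thesis
      using last snoc qr by simp
  qed
qed

text \<open>Shortcutting the walk from w back to z to a path makes its vertices distinct; putting
  the arc (z, w) in front closes it to a cycle.\<close>

lemma on_zero_cycle:
  assumes "(z, w) \<in> zero_arcs" "(w, z) \<in> zero_arcs\<^sup>*"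
  obtains C where "C \<in> zero_cycles G \<Delta>" "z \<in> cycle_verts C"
proof -
  have "z \<in> pverts G"
    using assms(1) zero_arcs_subset in_arcsD1 by blast
  then obtain p where "zero.awalk w p z"
    using rtrancl_imp_zero_awalk assms(2) by blast
  then have "zero.apath w (zero.awalk_to_apath p) z"
    by (rule zero.apath_awalk_to_apath)
  then obtain q where q: "zero.apath w q z" ..
  have "zero.awalk z ((z, w) # q) z"
    using q assms(1) by (auto simp: zero.awalk_simps zero.apath_def)
  moreover have "distinct (tl (pawalk_verts z ((z, w) # q)))"
    using q by (auto simp: zero.apath_def)
  ultimately have "zero.cycle ((z, w) # q)"
    by (auto simp: zero.cycle_def)
  then have "rotation_rel `` {(z, w) # q} \<in> zero_cycles G \<Delta>"
    by (auto simp: zero_cycles_def intro: quotientI)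
  moreover have "((z, w) # q, (z, w) # q) \<in> rotation_rel"
    by (auto simp: rotation_rel_def intro: exI[of _ 0])
  then have "z \<in> cycle_verts (rotation_rel `` {(z, w) # q})"
    by (force simp: cycle_verts_def)
  ultimately show thesis
    by (rule that)
qed

text \<open>Following zero exits forward from any vertex must revisit a vertex, and the stretch
  between the two visits leads back to it.\<close>

lemma zero_cycles_nonempty: "zero_cycles G \<Delta> \<noteq> {}"
proof -
  obtain f where f: "\<And>x. x \<in> pverts G \<Longrightarrow> (x, f x) \<in> zero_arcs"
    using zero_exit unfolding zero_arcs_def by (metis (mono_tags, lifting) mem_Collect_eq)
  obtain x where x: "x \<in> pverts G"
    using pverts_nonempty by blast
  have V: "(f ^^ n) x \<in> pverts G" for n
    by (induction n) (use x f zero_arcs_subset in_arcsD2 in auto)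
  obtain i j where ij: "i < j" "(f ^^ i) x = (f ^^ j) x"
    using finite_range_repeats[OF pair_finite_verts V] .
  have step: "((f ^^ n) x, (f ^^ Suc n) x) \<in> zero_arcs" for n
    using f V by simp
  \<comment> \<open>The stretch begins at \<open>Suc i\<close> because the arc out of the repeated
    vertex is the one that \<open>on_zero_cycle\<close> takes separately.\<close>
  have "((f ^^ Suc i) x, (f ^^ j) x) \<in> zero_arcs\<^sup>*"
    using step ij(1) by (intro rtrancl_along_sequence) auto
  then have "((f ^^ Suc i) x, (f ^^ i) x) \<in> zero_arcs\<^sup>*"
    by (simp only: ij(2))
  with step obtain C where "C \<in> zero_cycles G \<Delta>"
    by (rule on_zero_cycle)
  then show ?thesis
    by blast
qed

section \<open>Quasipotentials\<close>

lemma quasipotential_le: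
  assumes "C \<in> zero_cycles G \<Delta>" "z \<in> cycle_verts C"
  shows "quasipotential G \<Delta> C x \<le> path_dist G \<Delta> z x"
  using assms finite_cycle_verts by (auto simp: quasipotential_def dist_from_set_def)

lemma quasipotential_attained:
  assumes "C \<in> zero_cycles G \<Delta>"
  obtains z where "z \<in> cycle_verts C" "quasipotential G \<Delta> C x = path_dist G \<Delta> z x"
proof -
  have "quasipotential G \<Delta> C x \<in> (\<lambda>z. path_dist G \<Delta> z x) ` cycle_verts C"
    unfolding quasipotential_def dist_from_set_def
    using assms finite_cycle_verts cycle_verts_nonempty by (intro Min_in) auto
  then show thesis
    using that by auto
qed

lemma quasipotential_step:
  assumes "C \<in> zero_cycles G \<Delta>" "(y, x) \<in> parcs G"
  shows "quasipotential G \<Delta> C x \<le> quasipotential G \<Delta> C y + \<Delta> (y, x)"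
proof -
  obtain z where z: "z \<in> cycle_verts C" "quasipotential G \<Delta> C y = path_dist G \<Delta> z y"
    using quasipotential_attained assms(1) .
  then have "quasipotential G \<Delta> C x \<le> path_dist G \<Delta> z x"
    using quasipotential_le assms(1) by blast
  also have "\<dots> \<le> path_dist G \<Delta> z y + \<Delta> (y, x)"
    using path_dist_step z(1) cycle_verts_in_pverts assms by blast
  finally show ?thesis
    by (simp add: z(2))
qed

section \<open>The equation as inequality along arcs plus attainment\<close>

lemma hj_solutions_iff:
  "W \<in> hj_solutions G \<Delta> \<longleftrightarrow> W \<in> extensional (pverts G) \<and>
     (\<forall>(y, x) \<in> parcs G. W x \<le> W y + \<Delta> (y, x)) \<and>
     (\<forall>x \<in> pverts G. \<exists>y. (y, x) \<in> parcs G \<and> W x = W y + \<Delta> (y, x))"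
proof -
  have key: "W x = Min ((\<lambda>y. W y + \<Delta> (y, x)) ` {y. (y, x) \<in> parcs G}) \<longleftrightarrow>
      (\<forall>y. (y, x) \<in> parcs G \<longrightarrow> W x \<le> W y + \<Delta> (y, x)) \<and>
      (\<exists>y. (y, x) \<in> parcs G \<and> W x = W y + \<Delta> (y, x))" if x: "x \<in> pverts G" for x
  proof -
    have "{y. (y, x) \<in> parcs G} \<subseteq> pverts G"
      using in_arcsD1 by blast
    then have "finite {y. (y, x) \<in> parcs G}"
      using pair_finite_verts finite_subset by blast
    moreover have "{y. (y, x) \<in> parcs G} \<noteq> {}"
      using has_predecessor[OF x] by blast
    ultimately show ?thesis
      by (subst eq_Min_iff) auto
  qed
  have "W \<in> hj_solutions G \<Delta> \<longleftrightarrow> W \<in> extensional (pverts G) \<and>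
      (\<forall>x \<in> pverts G. (\<forall>y. (y, x) \<in> parcs G \<longrightarrow> W x \<le> W y + \<Delta> (y, x)) \<and>
        (\<exists>y. (y, x) \<in> parcs G \<and> W x = W y + \<Delta> (y, x)))"
    by (simp add: hj_solutions_def PiE_def key cong: ball_cong)
  \<comment> \<open>Heads of arcs are vertices, so ranging over arcs is the same as ranging over
    vertices and their predecessors.\<close>
  then show ?thesis
    using in_arcsD2 by blast
qed

text \<open>Each quasipotential plus a constant obeys the inequality along arcs, and this survives
  taking the minimum. Attainment at x comes from a shortest walk to x from the cycle that realises
  the minimum there.\<close>

lemma hj_combination_in_hj_solutions: "hj_combination G \<Delta> l \<in> hj_solutions G \<Delta>"
proof -
  define W where "W = hj_combination G \<Delta> l"
  have W_le: "W x \<le> quasipotential G \<Delta> C x + l C"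
    if "x \<in> pverts G" "C \<in> zero_cycles G \<Delta>" for x C
    using that finite_zero_cycles by (auto simp: W_def hj_combination_def)
  have W_attained: "\<exists>C \<in> zero_cycles G \<Delta>. W x = quasipotential G \<Delta> C x + l C"
    if "x \<in> pverts G" for x
  proof -
    have "W x \<in> (\<lambda>C. quasipotential G \<Delta> C x + l C) ` zero_cycles G \<Delta>"
      using that finite_zero_cycles zero_cycles_nonempty
      unfolding W_def hj_combination_def restrict_apply'[OF that] by (intro Min_in) auto
    then show ?thesis
      by blast
  qed
  have sub: "W x \<le> W y + \<Delta> (y, x)" if yx: "(y, x) \<in> parcs G" for x y
  proof -
    obtain C where C: "C \<in> zero_cycles G \<Delta>" "W y = quasipotential G \<Delta> C y + l C"
      using W_attained in_arcsD1[OF yx] by blast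
    show ?thesis
      using W_le[OF in_arcsD2[OF yx] C(1)] quasipotential_step[OF C(1) yx] C(2) by linarith
  qed
  have "\<exists>y. (y, x) \<in> parcs G \<and> W x = W y + \<Delta> (y, x)" if x: "x \<in> pverts G" for x
  proof -
    obtain C where C: "C \<in> zero_cycles G \<Delta>" "W x = quasipotential G \<Delta> C x + l C"
      using W_attained[OF x] by blast
    obtain z where z: "z \<in> cycle_verts C" "quasipotential G \<Delta> C x = path_dist G \<Delta> z x"
      using quasipotential_attained C(1) .
    have "z \<in> pverts G"
      using z(1) C(1) cycle_verts_in_pverts by blast
    then obtain p where p: "awalk z p x" "path_dist G \<Delta> z x = sum_list (map \<Delta> p)"
      using path_dist_attained x by blast
    \<comment> \<open>One inequality suffices here, as \<open>sub\<close> supplies the opposite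
      one.\<close>
    have "\<exists>y. (y, x) \<in> parcs G \<and> W y + \<Delta> (y, x) \<le> W x"
    proof (cases p rule: rev_cases)
      case Nil
      then have [simp]: "z = x" and Wx: "W x = l C"
        using p z C by (auto simp: awalk_simps)
      \<comment> \<open>Since y lies on C as well, \<open>W y\<close> is at most \<open>l C\<close>,
        which is \<open>W x\<close>, and the arc from y to x costs nothing.\<close>
      obtain y where y: "y \<in> cycle_verts C" "(y, x) \<in> zero_arcs"
        using cycle_verts_predecessor C(1) z(1) by auto
      then have yx: "(y, x) \<in> parcs G" "\<Delta> (y, x) = 0"
        by (auto simp: zero_arcs_def)
      have "W y \<le> path_dist G \<Delta> y y + l C"
        using W_le[OF in_arcsD1[OF yx(1)] C(1)] quasipotential_le[OF C(1) y(1), of y] by linarith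
      then show ?thesis
        using path_dist_self_le[OF in_arcsD1[OF yx(1)]] yx Wx by (intro exI[of _ y]) simp
    next
      case (snoc q e)
      then obtain y where y: "e = (y, x)" "(y, x) \<in> parcs G" "awalk z q y"
        using p(1) by (cases e) (auto simp: awalk_simps)
      \<comment> \<open>Without its last arc the shortest walk is a walk q to y, whose cost bounds
        the distance from z to y; the weight of the removed arc makes up the difference to
        \<open>W x\<close>.\<close>
      have "W y \<le> path_dist G \<Delta> z y + l C"
        using W_le[OF in_arcsD1[OF y(2)] C(1)] quasipotential_le[OF C(1) z(1), of y] by linarith
      also have "\<dots> \<le> sum_list (map \<Delta> q) + l C"
        using path_dist_le[OF y(3)] by simp
      finally show ?thesis
        using y(1,2) C(2) z(2) p(2) snoc by (intro exI[of _ y]) simp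
    qed
    then show ?thesis
      using sub by (meson order_antisym)
  qed
  moreover have "W \<in> extensional (pverts G)"
    by (simp add: W_def hj_combination_def)
  ultimately show ?thesis
    using sub unfolding W_def[symmetric] hj_solutions_iff by blast
qed

section \<open>Representing a solution by its values on the zero cycles\<close>

lemma hj_solution_step:
  assumes "W \<in> hj_solutions G \<Delta>" "(y, x) \<in> parcs G"
  shows "W x \<le> W y + \<Delta> (y, x)"
  using assms unfolding hj_solutions_iff by blast

lemma hj_solution_le_path_dist:
  assumes "W \<in> hj_solutions G \<Delta>" "y \<in> pverts G" "x \<in> pverts G"
  shows "W x \<le> W y + path_dist G \<Delta> y x"
proof -
  have "W x \<le> W y + sum_list (map \<Delta> p)" if "awalk y p x" for p
    using that
  proof (induction p arbitrary: y)
    case (Cons e p)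
    then have "W (snd e) \<le> W (fst e) + \<Delta> e" "fst e = y" "W x \<le> W (snd e) + sum_list (map \<Delta> p)"
      using hj_solution_step[OF assms(1), of "fst e" "snd e"] by (auto simp: awalk_simps)
    then show ?case
      by simp
  qed (simp add: awalk_simps)
  then show ?thesis
    using path_dist_attained assms(2,3) by metis
qed

text \<open>A solution cannot increase along zero arcs, and any two vertices of a zero cycle reach
  each other along such arcs.\<close>

lemma hj_solution_const_on_cycle:
  assumes "W \<in> hj_solutions G \<Delta>" "C \<in> zero_cycles G \<Delta>" "x \<in> cycle_verts C" "y \<in> cycle_verts C"
  shows "W x = W y"
proof -
  have "W v \<le> W u" if "(u, v) \<in> zero_arcs\<^sup>*" for u v
    using that
  proof (induction rule: rtrancl_induct)
    case (step v w)
    then have "W w \<le> W v + 0"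
      using hj_solution_step[OF assms(1), of v w] by (simp add: zero_arcs_def)
    then show ?case
      using step.IH by simp
  qed simp
  then show ?thesis
    using cycle_verts_connected[OF assms(2)] assms(3,4) by (meson order_antisym)
qed

lemma hj_solution_attained_from_cycle:
  assumes W: "W \<in> hj_solutions G \<Delta>" and x: "x \<in> pverts G"
  obtains C z where "C \<in> zero_cycles G \<Delta>" "z \<in> cycle_verts C" "W z + path_dist G \<Delta> z x \<le> W x"
proof -
  obtain f where f: "\<And>x. x \<in> pverts G \<Longrightarrow> (f x, x) \<in> parcs G \<and> W x = W (f x) + \<Delta> (f x, x)"
    using W unfolding hj_solutions_iff by metis
  define g where "g n = (f ^^ n) x" for n
  have V: "g n \<in> pverts G" for n
    unfolding g_def by (induction n) (use x f in_arcsD1 in auto)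
  have g: "(g (Suc n), g n) \<in> parcs G" "W (g n) = W (g (Suc n)) + \<Delta> (g (Suc n), g n)" for n
    using f[OF V[of n]] by (simp_all add: g_def)
  \<comment> \<open>Each backward step lowers W by exactly the weight of the arc that is prepended
    to the walk to x.\<close>
  have dist: "W (g n) + path_dist G \<Delta> (g n) x \<le> W x" for n
  proof (induction n)
    case 0
    then show ?case
      using path_dist_self_le[OF x] by (simp add: g_def)
  next
    case (Suc n)
    then show ?case
      using path_dist_first_step[OF g(1) x, of n] g(2)[of n] by linarith
  qed
  obtain i j where ij: "i < j" "g i = g j"
    using finite_range_repeats[OF pair_finite_verts V] .
  \<comment> \<open>Weights are nonnegative, so W decreases along g. As \<open>g i\<close> and
    \<open>g j\<close> coincide, W is constant in between, which forces the weights there to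
    vanish.\<close>
  have dec: "decseq (\<lambda>n. W (g n))"
  proof (rule decseq_SucI)
    show "W (g (Suc n)) \<le> W (g n)" for n
      using g(2)[of n] nonneg[OF g(1)[of n]] by linarith
  qed
  have zero: "(g (Suc n), g n) \<in> zero_arcs" if "i \<le> n" "n < j" for n
  proof -
    have "W (g n) \<le> W (g i)" "W (g j) \<le> W (g (Suc n))"
      using that by (auto intro: decseqD[OF dec])
    then have "\<Delta> (g (Suc n), g n) = 0"
      using ij(2) g(2)[of n] nonneg[OF g(1)[of n]] by simp
    then show ?thesis
      using g(1) by (simp add: zero_arcs_def)
  qed
  \<comment> \<open>Arcs run from \<open>g (Suc n)\<close> to \<open>g n\<close>, hence the
    converse. Stopping at \<open>j - 1\<close> leaves the arc from \<open>g j\<close> to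
    \<open>g (j - 1)\<close> to close the cycle.\<close>
  have "(g i, g (j - 1)) \<in> (zero_arcs\<inverse>)\<^sup>*"
    using ij(1) zero by (intro rtrancl_along_sequence) auto
  then have "(g (j - 1), g j) \<in> zero_arcs\<^sup>*"
    using ij(2) by (simp add: rtrancl_converse)
  moreover have "(g j, g (j - 1)) \<in> zero_arcs"
    using zero[of "j - 1"] ij(1) by simp
  ultimately obtain C where "C \<in> zero_cycles G \<Delta>" "g j \<in> cycle_verts C"
    using on_zero_cycle by blast
  then show thesis
    using that dist by blast
qed

lemma hj_solution_is_hj_combination:
  assumes W: "W \<in> hj_solutions G \<Delta>"
  shows "W \<in> hj_combination G \<Delta> ` cycle_polyhedron G \<Delta>"
proof -
  \<comment> \<open>The choice of the vertex does not matter, by constancy on cycles; the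
    restriction to \<open>zero_cycles\<close> makes l extensional, as membership in the polyhedron
    demands.\<close>
  define l where "l = (\<lambda>C \<in> zero_cycles G \<Delta>. W (SOME z. z \<in> cycle_verts C))"
  have l_eq: "l C = W z" if "C \<in> zero_cycles G \<Delta>" "z \<in> cycle_verts C" for C z
  proof -
    have "(SOME z. z \<in> cycle_verts C) \<in> cycle_verts C"
      using that(2) by (rule someI)
    then show ?thesis
      using hj_solution_const_on_cycle[OF W that(1) _ that(2)] by (simp add: l_def that(1))
  qed
  have le_dist: "W x \<le> l C + path_dist G \<Delta> z x"
    if "C \<in> zero_cycles G \<Delta>" "z \<in> cycle_verts C" "x \<in> pverts G" for C z x
    using hj_solution_le_path_dist[OF W _ that(3)] l_eq[OF that(1,2)] that(1,2)
      cycle_verts_in_pverts by auto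
  have "l \<in> cycle_polyhedron G \<Delta>"
    unfolding cycle_polyhedron_def
  proof (intro CollectI conjI ballI)
    show "l \<in> zero_cycles G \<Delta> \<rightarrow>\<^sub>E UNIV"
      by (simp add: l_def)
  next
    fix C D assume C: "C \<in> zero_cycles G \<Delta>" and D: "D \<in> zero_cycles G \<Delta>"
    \<comment> \<open>The bound \<open>le_dist\<close> based at y on D is read at x on C, where W
      equals \<open>l C\<close>.\<close>
    have "l C - l D \<le> path_dist G \<Delta> y x" if "y \<in> cycle_verts D" "x \<in> cycle_verts C" for x y
      using le_dist[OF D that(1)] l_eq[OF C that(2)] cycle_verts_in_pverts[OF C] that(2)
      by (smt (verit) subsetD)
    then show "l C - l D \<le> dist_sets G \<Delta> (cycle_verts D) (cycle_verts C)"
      unfolding dist_sets_def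
      using C D finite_cycle_verts cycle_verts_nonempty by (subst Min_ge_iff) auto
  qed
  moreover have "W = hj_combination G \<Delta> l"
  proof
    fix x
    show "W x = hj_combination G \<Delta> l x"
    proof (cases "x \<in> pverts G")
      case True
      have "W x \<le> quasipotential G \<Delta> C x + l C" if "C \<in> zero_cycles G \<Delta>" for C
        using quasipotential_attained[OF that, of x] le_dist[OF that _ True]
        by (metis add.commute)
      moreover obtain C z where Cz: "C \<in> zero_cycles G \<Delta>" "z \<in> cycle_verts C"
        "W z + path_dist G \<Delta> z x \<le> W x"
        using hj_solution_attained_from_cycle[OF W True] .
      \<comment> \<open>At the cycle reached by the backward chain \<open>W z\<close> is
        \<open>l C\<close>, so the minimum is attained there.\<close>
      moreover have "quasipotential G \<Delta> C x + l C \<le> W x"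
        using quasipotential_le[OF Cz(1,2), of x] l_eq[OF Cz(1,2)] Cz(3) by linarith
      ultimately have "W x = Min ((\<lambda>C. quasipotential G \<Delta> C x + l C) ` zero_cycles G \<Delta>)"
        using finite_zero_cycles zero_cycles_nonempty
        by (subst eq_Min_iff) (auto intro: order_antisym)
      then show ?thesis
        by (simp add: hj_combination_def True)
    next
      \<comment> \<open>Outside the vertex set both functions are \<open>undefined\<close>.\<close>
      case False
      then show ?thesis
        using W by (simp add: hj_combination_def hj_solutions_def extensional_def PiE_def)
    qed
  qed
  ultimately show ?thesis
    by blast
qed

end

theorem theorem5p7:
  fixes G :: "'a pair_pre_digraph" and \<Delta> :: "('a \<times> 'a) weight_fun"
  assumes "pair_digraph G"
    and "strongly_connected (with_proj G)"
    and "\<forall>e \<in> parcs G. 0 \<le> \<Delta> e"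
    and "\<forall>x \<in> pverts G. \<exists>!y. (x, y) \<in> parcs G \<and> \<Delta> (x, y) = 0"
  shows "hj_solutions G \<Delta> = hj_combination G \<Delta> ` cycle_polyhedron G \<Delta>"
proof -
  interpret pair_digraph G
    by fact
  interpret zero_exit_digraph G \<Delta>
    using assms by unfold_locales auto
  show ?thesis
    using hj_combination_in_hj_solutions hj_solution_is_hj_combination by blast
qed

end
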